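(* Let $n$ be a positive integer. The sum of $\mu_1-l(\mu)+\frac{1+(-1)^{r(\mu)}}{2}$ over all partitions $\mu$ of $n$ into distinct parts equals the sum of $\lambda_1$ over all partitions $\lambda$ of $n$ into odd parts; namely, $$\sum_{\mu\in D_n}\left(\mu_1-l(\mu)+\frac{1+(-1)^{r(\mu)}}{2}\right)=\sum_{\lambda\in O_n}\lambda_1.$$
   Context: A partition $\lambda$ of a positive integer $n$ is a finite nonincreasing sequence of positive integers $\lambda_1,\lambda_2,\ldots,\lambda_r$ with $\sum_i\lambda_i=n$; the $\lambda_i$ are its parts, $\lambda_1$ is its largest part, and $l(\lambda)=r$ is its number of parts (its length). The rank of $\lambda$ is $r(\lambda)=\lambda_1-l(\lambda)$. $D_n$ is the set of partitions of $n$ into distinct parts, and $O_n$ is the set of partitions of $n$ into odd parts (repetitions allowed). *)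

theory Defs
  imports Complex_Main
begin

definition is_partition :: "nat \<Rightarrow> nat list \<Rightarrow> bool" where
  "is_partition n xs \<longleftrightarrow> sorted_wrt (\<ge>) xs \<and> (\<forall>x\<in>set xs. 0 < x) \<and> sum_list xs = n"

text \<open>\<open>largest_part []\<close> is unspecified; the empty list is a partition of \<open>0\<close> only.\<close>

definition largest_part :: "nat list \<Rightarrow> nat" where
  "largest_part xs = hd xs"

definition partition_rank :: "nat list \<Rightarrow> int" where
  "partition_rank xs = int (largest_part xs) - int (length xs)"

definition distinct_partitions :: "nat \<Rightarrow> nat list set" where
  "distinct_partitions n = {xs. is_partition n xs \<and> distinct xs}"

definition odd_partitions :: "nat \<Rightarrow> nat list set" where
  "odd_partitions n = {xs. is_partition n xs \<and> (\<forall>x\<in>set xs. odd x)}"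

text \<open>The sums over these sets are therefore not the default value \<open>0\<close> of an infinite sum.\<close>

lemma finite_partitions: "finite {xs. is_partition n xs}"
proof (rule finite_subset)
  show "{xs. is_partition n xs} \<subseteq> {xs. set xs \<subseteq> {..n} \<and> length xs \<le> n}"
  proof
    fix xs assume "xs \<in> {xs. is_partition n xs}"
    then have pos: "\<forall>x\<in>set xs. 0 < x" and s: "sum_list xs = n"
      by (auto simp: is_partition_def)
    have "length xs \<le> sum_list xs"
      using pos by (induction xs) auto
    moreover have "set xs \<subseteq> {..n}"
      using s member_le_sum_list by fastforce
    ultimately show "xs \<in> {xs. set xs \<subseteq> {..n} \<and> length xs \<le> n}"
      using s by simp
  qed
  show "finite {xs. set xs \<subseteq> {..n} \<and> length xs \<le> n}"
    by (rule finite_lists_length_le) simp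
qed

lemma finite_distinct_partitions: "finite (distinct_partitions n)"
  by (rule finite_subset[OF _ finite_partitions[of n]]) (auto simp: distinct_partitions_def)

lemma finite_odd_partitions: "finite (odd_partitions n)"
  by (rule finite_subset[OF _ finite_partitions[of n]]) (auto simp: odd_partitions_def)

end

theory Submission
  imports Defs
begin

text \<open>
  The summand is the rank \<open>\<mu>\<^sub>1 - l(\<mu>)\<close> rounded up to an odd number: it is \<open>2k + 1\<close> exactly
  when the rank is \<open>2k\<close> or \<open>2k + 1\<close>.  So the theorem follows from Fine's
  refinement of Euler's theorem: among the partitions of \<open>n\<close>, those into distinct parts with
  rounded rank \<open>r\<close> are as many as those into odd parts with largest part \<open>r\<close>.

  Fine's theorem holds because both counts satisfy the same recurrence in \<open>n\<close>.  Let \<open>r\<close> be odd.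
  Removing the largest part \<open>r\<close> of an odd partition of \<open>n + r\<close> leaves an arbitrary odd
  partition of \<open>n\<close> with parts at most \<open>r\<close> (\<open>bij_betw_Cons_largest_part\<close>).  On the other side,
  Dyson's map turns the first column of a Ferrers diagram into a new first row and makes it
  longer by \<open>r\<close>; it is a bijection from the distinct partitions of \<open>n\<close> with rounded
  rank at most \<open>r\<close> to those of \<open>n + r\<close> with rounded rank \<open>r\<close>
  (\<open>bij_betw_dyson\<close>).  Removing a column keeps distinct parts distinct, except that it may create
  one part \<open>0\<close>, which is dropped; whether it does decides which of the ranks \<open>r\<close> and \<open>r - 1\<close>
  comes out, and this is why two ranks correspond to one odd number.
\<close>

section \<open>Comparing two statistics fibre by fibre\<close>

text \<open>
  The map \<open>\<phi>\<close> is a parameter because two cases matter: an inclusion of \<open>nat\<close> into \<open>real\<close> gives the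
  sums of the statistics, and the indicator of a down-set gives the number of elements below a bound.
\<close>

lemma sum_comp_eq_if_card_fibres_eq:
  fixes \<phi> :: "'c \<Rightarrow> 'd :: semiring_1"
  assumes "finite A" "finite B"
    and fibres: "\<And>c. card {a \<in> A. f a = c} = card {b \<in> B. g b = c}"
  shows "(\<Sum>a\<in>A. \<phi> (f a)) = (\<Sum>b\<in>B. \<phi> (g b))"
proof -
  let ?T = "f ` A \<union> g ` B"
  have "(\<Sum>a\<in>A. \<phi> (f a)) = (\<Sum>c\<in>?T. \<Sum>a\<in>{a \<in> A. f a = c}. \<phi> (f a))"
    by (rule sum.group[symmetric]) (use assms in auto)
  also have "\<dots> = (\<Sum>c\<in>?T. of_nat (card {a \<in> A. f a = c}) * \<phi> c)"
    by (intro sum.cong refl) simp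
  also have "\<dots> = (\<Sum>c\<in>?T. \<Sum>b\<in>{b \<in> B. g b = c}. \<phi> (g b))"
    unfolding fibres by (intro sum.cong refl) simp
  also have "\<dots> = (\<Sum>b\<in>B. \<phi> (g b))"
    by (rule sum.group) (use assms in auto)
  finally show ?thesis .
qed

lemma card_Collect_le_eq_if_card_fibres_eq:
  fixes f :: "'a \<Rightarrow> 'c :: ord"
  assumes "finite A" "finite B"
    and "\<And>c. card {a \<in> A. f a = c} = card {b \<in> B. g b = c}"
  shows "card {a \<in> A. f a \<le> r} = card {b \<in> B. g b \<le> r}"
  using sum_comp_eq_if_card_fibres_eq[OF assms, of "\<lambda>c. of_bool (c \<le> r) :: nat"] assms(1,2)
  by (simp add: sum.If_cases of_bool_def Int_def)

section \<open>The two statistics\<close>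

text \<open>
  Both statistics are \<open>0\<close> at the empty partition.  It then satisfies every bound ``at most \<open>r\<close>'',
  so that the recurrence also produces the partition with the single part \<open>r\<close>; and \<open>0\<close>, being
  even, is not a value at any other partition.
\<close>

definition largest_part0 :: "nat list \<Rightarrow> nat" where
  "largest_part0 xs = (if xs = [] then 0 else hd xs)"

definition odd_rank :: "nat list \<Rightarrow> nat" where
  "odd_rank xs = (if xs = [] then 0 else 2 * ((hd xs - length xs) div 2) + 1)"

lemma distinct_partitions_iff:
  "xs \<in> distinct_partitions n \<longleftrightarrow> sorted_wrt (>) xs \<and> (\<forall>x\<in>set xs. 0 < x) \<and> sum_list xs = n"
proof -
  have "sorted_wrt (>) xs \<longleftrightarrow> sorted_wrt (\<ge>) xs \<and> distinct xs"
    by (induction xs) (auto simp: order.order_iff_strict)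
  then show ?thesis
    by (auto simp: distinct_partitions_def is_partition_def)
qed

lemma length_le_hd_if_strictly_decreasing:
  fixes x :: nat
  assumes "sorted_wrt (>) (x # xs)" "\<forall>y\<in>set (x # xs). 0 < y"
  shows "Suc (length xs) \<le> x"
  using assms
proof (induction xs arbitrary: x)
  case (Cons y ys)
  then have "Suc (length ys) \<le> y" by simp
  with Cons.prems show ?case by simp
qed simp

lemma empty_partition_unique:
  "xs \<in> distinct_partitions n \<Longrightarrow> xs = [] \<longleftrightarrow> n = 0"
  "xs \<in> odd_partitions n \<Longrightarrow> xs = [] \<longleftrightarrow> n = 0"
  by (cases xs; force simp: distinct_partitions_iff odd_partitions_def is_partition_def)+

lemma summand_eq_odd_rank:
  assumes "\<mu> \<in> distinct_partitions n" "n > 0"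
  shows "real (largest_part \<mu>) - real (length \<mu>) + (1 + (-1) powi partition_rank \<mu>) / 2
           = real (odd_rank \<mu>)"
proof -
  from assms empty_partition_unique(1) obtain x xs where \<mu>: "\<mu> = x # xs"
    by (cases \<mu>) auto
  with assms have "Suc (length xs) \<le> x"
    by (intro length_le_hd_if_strictly_decreasing) (auto simp: distinct_partitions_iff)
  then obtain d where x: "x = Suc (length xs) + d"
    using le_Suc_ex by blast
  have rank: "partition_rank \<mu> = int d"
    by (simp add: \<mu> x partition_rank_def largest_part_def)
  show ?thesis
  proof (cases "even d")
    case True
    then show ?thesis
      unfolding rank by (auto simp: \<mu> x odd_rank_def largest_part_def elim!: evenE)
  next
    case False
    then show ?thesis
      unfolding rank by (auto simp: \<mu> x odd_rank_def largest_part_def elim!: oddE)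
  qed
qed

section \<open>Removing the first column of a Ferrers diagram\<close>

definition remove_column :: "nat list \<Rightarrow> nat list" where
  "remove_column xs = filter (\<lambda>x. 0 < x) (map (\<lambda>x. x - 1) xs)"

definition add_column :: "nat \<Rightarrow> nat list \<Rightarrow> nat list" where
  "add_column m xs = map Suc xs @ replicate (m - length xs) 1"

lemma remove_column_add_column:
  "\<forall>x\<in>set xs. 0 < x \<Longrightarrow> remove_column (add_column m xs) = xs"
  by (simp add: remove_column_def add_column_def comp_def)

lemma sum_list_remove_column:
  "\<forall>x\<in>set xs. 0 < x \<Longrightarrow> sum_list (remove_column xs) + length xs = sum_list xs"
  by (induction xs) (auto simp: remove_column_def)

text \<open>Among distinct parts only the last one can be \<open>1\<close>, so at most one row disappears.\<close>

lemma remove_column_strictly_decreasing: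
  assumes "sorted_wrt (>) xs" "\<forall>x\<in>set xs. 0 < x"
  shows "sorted_wrt (>) (remove_column xs)"
    and "length (remove_column xs) = length xs \<or> Suc (length (remove_column xs)) = length xs"
    and "add_column (length xs) (remove_column xs) = xs"
proof -
  have "sorted_wrt (>) (remove_column xs) \<and>
      (length (remove_column xs) = length xs \<or> Suc (length (remove_column xs)) = length xs) \<and>
      add_column (length xs) (remove_column xs) = xs"
    using assms
  proof (induction xs)
    case Nil
    then show ?case by (simp add: remove_column_def add_column_def)
  next
    case (Cons x xs)
    show ?case
    proof (cases "x = 1")
      case True
      with Cons.prems have "xs = []" by (cases xs) auto
      with True show ?thesis by (simp add: remove_column_def add_column_def)
    next
      case False
      with Cons.prems have rc: "remove_column (x # xs) = (x - 1) # remove_column xs"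
        by (auto simp: remove_column_def)
      have "\<forall>y\<in>set (remove_column xs). y < x - 1"
        using Cons.prems by (fastforce simp: remove_column_def)
      with Cons rc False show ?thesis by (auto simp: add_column_def)
    qed
  qed
  then show "sorted_wrt (>) (remove_column xs)"
    and "length (remove_column xs) = length xs \<or> Suc (length (remove_column xs)) = length xs"
    and "add_column (length xs) (remove_column xs) = xs"
    by blast+
qed

section \<open>Dyson's map\<close>

definition dyson :: "nat \<Rightarrow> nat list \<Rightarrow> nat list" where
  "dyson r xs = (length xs + r) # remove_column xs"

definition undyson :: "nat \<Rightarrow> nat list \<Rightarrow> nat list" where
  "undyson r ys = add_column (hd ys - r) (tl ys)"

lemma undyson_dyson:
  "xs \<in> distinct_partitions n \<Longrightarrow> undyson r (dyson r xs) = xs"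
  by (simp add: undyson_def dyson_def remove_column_strictly_decreasing distinct_partitions_iff)

text \<open>
  The bound on the rounded rank says that the new first row, of length \<open>length xs + r\<close>,
  is longer than the former first row without its first cell.
\<close>

lemma dyson_in_distinct_partitions:
  assumes xs: "xs \<in> distinct_partitions n" and rank: "odd_rank xs \<le> r" and "odd r"
  shows "dyson r xs \<in> distinct_partitions (n + r)" and "odd_rank (dyson r xs) = r"
proof -
  have dec: "sorted_wrt (>) xs" and pos: "\<forall>x\<in>set xs. 0 < x" and sum: "sum_list xs = n"
    using xs by (auto simp: distinct_partitions_iff)
  note column = remove_column_strictly_decreasing[OF dec pos]
  have "\<forall>y\<in>set (remove_column xs). y < length xs + r"
  proof (cases xs)
    case Nil
    then show ?thesis by (simp add: remove_column_def)
  next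
    case (Cons x ys)
    have "x \<le> length xs + r"
      using rank Cons by (simp add: odd_rank_def)
    moreover have "\<forall>y\<in>set xs. y \<le> x"
      using dec Cons by auto
    ultimately show ?thesis
      using pos by (fastforce simp: remove_column_def)
  qed
  moreover have "\<forall>y\<in>set (remove_column xs). 0 < y"
    by (auto simp: remove_column_def)
  ultimately show "dyson r xs \<in> distinct_partitions (n + r)"
    using column(1) sum_list_remove_column[OF pos] sum \<open>odd r\<close>
    by (auto simp: dyson_def distinct_partitions_iff odd_pos)
  show "odd_rank (dyson r xs) = r"
    using column(2) \<open>odd r\<close> by (auto simp: dyson_def odd_rank_def elim!: oddE)
qed

text \<open>
  Conversely, after deleting the first row \<open>y\<close> its excess \<open>y - r\<close> over \<open>r\<close> is the height of the column
  to put back.  In the result the first row is at most \<open>y\<close> and the length is \<open>y - r\<close>, so the rank is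
  at most \<open>r\<close>, and rounding up to an odd number does not pass the odd bound \<open>r\<close>.
\<close>

lemma undyson_in_distinct_partitions:
  assumes ys: "ys \<in> distinct_partitions (n + r)" and rank: "odd_rank ys = r" and "odd r"
  shows "undyson r ys \<in> distinct_partitions n" and "odd_rank (undyson r ys) \<le> r"
    and "dyson r (undyson r ys) = ys"
proof -
  obtain y t where yt: "ys = y # t"
    using rank \<open>odd r\<close> by (cases ys) (auto simp: odd_rank_def)
  have dec: "sorted_wrt (>) (y # t)" and pos: "\<forall>x\<in>set (y # t). 0 < x"
    and sum: "y + sum_list t = n + r"
    using ys yt by (auto simp: distinct_partitions_iff)
  define m where "m = y - r"
  \<comment> \<open>The rank is \<open>r\<close> or \<open>r - 1\<close>, so the new column sticks out below the others by at most one cell;\<close>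
  \<comment> \<open>hence adding it creates at most one part \<open>1\<close> and keeps the parts distinct.\<close>
  have ym: "y = m + r" and m: "m = length t \<or> m = Suc (length t)"
    using length_le_hd_if_strictly_decreasing[OF dec pos] rank yt
    unfolding m_def odd_rank_def by simp_all presburger+
  have un: "undyson r ys = add_column m t"
    by (simp add: undyson_def yt m_def)
  have dec': "sorted_wrt (>) (add_column m t)"
    using m dec pos by (auto simp: add_column_def sorted_wrt_append sorted_wrt_map)
  have len: "length (add_column m t) = m"
    using m by (auto simp: add_column_def)
  have pos': "\<forall>x\<in>set (add_column m t). 0 < x"
    by (auto simp: add_column_def)
  have rc: "remove_column (add_column m t) = t"
    using pos by (intro remove_column_add_column) auto
  show "undyson r ys \<in> distinct_partitions n"
    using un dec' pos' sum_list_remove_column[OF pos'] sum rc len ym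
    by (simp add: distinct_partitions_iff)
  show "dyson r (undyson r ys) = ys"
    unfolding un by (simp add: dyson_def rc len ym yt)
  show "odd_rank (undyson r ys) \<le> r"
  proof (cases "add_column m t")
    case Nil
    then show ?thesis by (simp add: un odd_rank_def)
  next
    case (Cons z zs)
    have "z \<le> m + r"
    proof -
      have "\<forall>x\<in>set (add_column m t). x \<le> m + r"
        using dec ym odd_pos[OF \<open>odd r\<close>] by (auto simp: add_column_def Suc_le_eq)
      with Cons show ?thesis by simp
    qed
    with Cons len un \<open>odd r\<close> show ?thesis
      by (auto simp: odd_rank_def elim!: oddE)
  qed
qed

lemma bij_betw_dyson:
  assumes "odd r"
  shows "bij_betw (dyson r) {xs \<in> distinct_partitions n. odd_rank xs \<le> r}
                            {ys \<in> distinct_partitions (n + r). odd_rank ys = r}"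
  by (rule bij_betw_byWitness[where f' = "undyson r"])
     (use assms in \<open>auto simp: undyson_dyson dyson_in_distinct_partitions
                              undyson_in_distinct_partitions\<close>)

section \<open>Fine's theorem\<close>

lemma bij_betw_Cons_largest_part:
  assumes "odd r"
  shows "bij_betw (Cons r) {xs \<in> odd_partitions n. largest_part0 xs \<le> r}
                           {ys \<in> odd_partitions (n + r). largest_part0 ys = r}"
proof (rule bij_betw_byWitness[where f' = tl])
  show "\<forall>ys\<in>{ys \<in> odd_partitions (n + r). largest_part0 ys = r}. r # tl ys = ys"
    using assms by (auto simp: largest_part0_def odd_pos)
  have "r # xs \<in> odd_partitions (n + r)"
    if "xs \<in> odd_partitions n" "largest_part0 xs \<le> r" for xs
    using that assms odd_pos[of r]
    by (cases xs) (auto simp: odd_partitions_def is_partition_def largest_part0_def)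
  then show "Cons r ` {xs \<in> odd_partitions n. largest_part0 xs \<le> r}
               \<subseteq> {ys \<in> odd_partitions (n + r). largest_part0 ys = r}"
    by (auto simp: largest_part0_def)
  have "tl ys \<in> odd_partitions n \<and> largest_part0 (tl ys) \<le> r"
    if "ys \<in> odd_partitions (n + r)" "largest_part0 ys = r" for ys
  proof (cases ys)
    case Nil
    then show ?thesis using that assms by (simp add: largest_part0_def)
  next
    case (Cons y t)
    then show ?thesis
      using that
      by (cases t) (auto simp: odd_partitions_def is_partition_def largest_part0_def)
  qed
  then show "tl ` {ys \<in> odd_partitions (n + r). largest_part0 ys = r}
               \<subseteq> {xs \<in> odd_partitions n. largest_part0 xs \<le> r}"
    by auto
qed simp

text \<open>
  For odd \<open>r\<close> the two bijections reduce the claim from \<open>n\<close> to \<open>n - r\<close>, with the condition ``equal to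
  \<open>r\<close>'' replaced by ``at most \<open>r\<close>''; the induction hypothesis for all values up to \<open>r\<close> together
  covers it.
\<close>

theorem card_odd_rank_eq_card_largest_part:
  "card {xs \<in> distinct_partitions n. odd_rank xs = r}
     = card {xs \<in> odd_partitions n. largest_part0 xs = r}"
proof (induction n arbitrary: r rule: less_induct)
  case (less n)
  consider (zero) "r = 0" | (even) "even r" "r > 0" | (large) "odd r" "n < r" | (step) "odd r" "r \<le> n"
    by fastforce
  then show ?case
  proof cases
    case zero
    have "xs \<in> distinct_partitions n \<and> odd_rank xs = 0 \<longleftrightarrow> xs = [] \<and> n = 0" for xs
      by (auto simp: odd_rank_def distinct_partitions_iff)
    moreover have "xs \<in> odd_partitions n \<and> largest_part0 xs = 0 \<longleftrightarrow> xs = [] \<and> n = 0" for xs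
      by (cases xs) (auto simp: largest_part0_def odd_partitions_def is_partition_def)
    ultimately show ?thesis using zero by simp
  next
    case even
    have "{xs \<in> distinct_partitions n. odd_rank xs = r} = {}"
      using even by (auto simp: odd_rank_def)
    moreover have "{xs \<in> odd_partitions n. largest_part0 xs = r} = {}"
      using even hd_in_set by (fastforce simp: largest_part0_def odd_partitions_def split: if_splits)
    ultimately show ?thesis by (simp only:)
  next
    case large
    have "odd_rank xs \<le> n" if "xs \<in> distinct_partitions n" for xs
    proof (cases xs)
      case (Cons x ys)
      with that have "0 < x" "x \<le> n" by (auto simp: distinct_partitions_iff)
      have "2 * ((x - Suc (length ys)) div 2) \<le> x - Suc (length ys)" by simp
      also have "\<dots> < x" using \<open>0 < x\<close> by simp
      finally show ?thesis using Cons \<open>x \<le> n\<close> by (simp add: odd_rank_def)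
    qed (simp add: odd_rank_def)
    then have "{xs \<in> distinct_partitions n. odd_rank xs = r} = {}"
      using large by fastforce
    moreover have "largest_part0 xs \<le> n" if "xs \<in> odd_partitions n" for xs
      using that by (cases xs) (auto simp: largest_part0_def odd_partitions_def is_partition_def)
    then have "{xs \<in> odd_partitions n. largest_part0 xs = r} = {}"
      using large by fastforce
    ultimately show ?thesis by (simp only:)
  next
    case step
    define m where "m = n - r"
    have n: "n = m + r" and "m < n"
      using step odd_pos[of r] by (auto simp: m_def)
    have "card {xs \<in> distinct_partitions n. odd_rank xs = r}
            = card {xs \<in> distinct_partitions m. odd_rank xs \<le> r}"
      unfolding n using bij_betw_same_card[OF bij_betw_dyson[OF step(1)]] by metis
    also have "\<dots> = card {xs \<in> odd_partitions m. largest_part0 xs \<le> r}"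
      by (intro card_Collect_le_eq_if_card_fibres_eq finite_distinct_partitions
            finite_odd_partitions less \<open>m < n\<close>)
    also have "\<dots> = card {xs \<in> odd_partitions n. largest_part0 xs = r}"
      unfolding n using bij_betw_same_card[OF bij_betw_Cons_largest_part[OF step(1)]] by metis
    finally show ?thesis .
  qed
qed

theorem theorem2p2:
  fixes n :: nat
  assumes "n > 0"
  shows "(\<Sum>\<mu>\<in>distinct_partitions n.
            real (largest_part \<mu>) - real (length \<mu>) + (1 + (-1) powi partition_rank \<mu>) / 2)
       = (\<Sum>\<nu>\<in>odd_partitions n. real (largest_part \<nu>))"
proof -
  have "(\<Sum>\<mu>\<in>distinct_partitions n.
            real (largest_part \<mu>) - real (length \<mu>) + (1 + (-1) powi partition_rank \<mu>) / 2)
          = (\<Sum>\<mu>\<in>distinct_partitions n. real (odd_rank \<mu>))"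
    using assms by (intro sum.cong refl summand_eq_odd_rank)
  also have "\<dots> = (\<Sum>\<nu>\<in>odd_partitions n. real (largest_part0 \<nu>))"
    by (intro sum_comp_eq_if_card_fibres_eq finite_distinct_partitions finite_odd_partitions
          card_odd_rank_eq_card_largest_part)
  also have "\<dots> = (\<Sum>\<nu>\<in>odd_partitions n. real (largest_part \<nu>))"
    using assms empty_partition_unique(2)
    by (intro sum.cong refl) (auto simp: largest_part0_def largest_part_def)
  finally show ?thesis .
qed

end
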